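(* Let $q\ge 2$ and let $\mathcal F\subseteq 2^{[n]}$ be a nonempty set family. For each $J\subseteq[n]$ with $\mathcal F_J\neq\emptyset$ let $\mathcal G(\mathcal F_J)$ be a fixed Gröbner basis of $I(\mathcal F_J)$. Then $$\{f_1,\ldots ,f_n\}\cup \bigcup_{J\subseteq [n]} \{x_J\cdot \overline{g}:~ g\in \mathcal G(\mathcal F_J)\}\cup \{x_J:~ J\subseteq[n],~ \mathcal F_J=\emptyset \}$$ is a Gröbner basis of the ideal $I(\mathcal F^q)$. Moreover, the set of standard monomials of $I(\mathcal F^q)$ is $$\{\mathbf{x}^{\mathbf v}:~\mathbf v\in (q)^n,~ \mathcal F_{J(\mathbf v)} \neq \emptyset,\ \text{and } x_{Q(\mathbf v)} \text{ is a standard monomial of } I(\mathcal F_{J(\mathbf v)})\}.$$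
   Context: $R=\mathbb{Q}[x_1,\ldots,x_n]$ with a fixed monomial order $\prec$ satisfying $x_n\prec\cdots\prec x_1$; $\mathrm{lm}(f)$ is the $\prec$-largest monomial of $f\neq 0$. A finite $\mathcal G\subseteq I$ is a Gröbner basis of the ideal $I$ if for every nonzero $f\in I$ some $g\in\mathcal G$ has $\mathrm{lm}(g)$ dividing $\mathrm{lm}(f)$. Standard monomials of $I$: monomials that are not $\mathrm{lm}(f)$ for any nonzero $f\in I$. For $\mathcal V\subseteq\mathbb{Q}^n$, $I(\mathcal V)$ is the ideal of polynomials vanishing on $\mathcal V$; a set family $\mathcal H\subseteq 2^{[n]}$ is identified with the set $\{\mathbf v_F:F\in\mathcal H\}\subseteq\{0,1\}^n$ of characteristic vectors, so $I(\mathcal H)$ means the ideal of that set. $(q)=\{0,\ldots,q-1\}$; $\mathbf x^{\mathbf v}=x_1^{v_1}\cdots x_n^{v_n}$; $x_J=\prod_{j\in J}x_j$ ($x_\emptyset=1$). $f_i=\prod_{j=0}^{q-1}(x_i-j)$ for $1\le i\le n$. Blow-up: $\mathcal F^q=\{\mathbf v\in(q)^n: \mathrm{supp}(\mathbf v)\in\mathcal F\}$, where $\mathrm{supp}(\mathbf v)=\{i:v_i\neq0\}$. $\mathcal F_J=\{F\in\mathcal F: J\subseteq F\}$. For $g\in R$, $\overline g(x_1,\ldots,x_n)=g(p(x_1),\ldots,p(x_n))$ where $p\in\mathbb{Q}[x]$ is the unique polynomial of degree $q-1$ with $p(0)=0$ and $p(i)=1$ for $1\le i\le q-1$. For $\mathbf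 v\in(q)^n$: $J(\mathbf v)=\{i:0<v_i<q-1\}$, $Q(\mathbf v)=\{i: v_i=q-1\}$. *)

theory Defs
  imports
    Complex_Main
    "HOL-Library.Poly_Mapping"
    "HOL-Library.Indicator_Function"
    "HOL-Computational_Algebra.Polynomial"
begin

text \<open>
  The index set \<open>[n]\<close> is a finite linearly ordered type \<open>'n\<close>. A monomial is represented by its
  exponent vector, so the product of monomials is \<open>+\<close> and the monomial \<open>1\<close> is \<open>0\<close>.
\<close>

type_synonym 'n monom = "'n \<Rightarrow>\<^sub>0 nat"

type_synonym 'n mpoly = "'n monom \<Rightarrow>\<^sub>0 rat"

definition Const :: "rat \<Rightarrow> 'n mpoly" where
  "Const c = Poly_Mapping.single 0 c"

definition mono_poly :: "'n monom \<Rightarrow> 'n mpoly" where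
  "mono_poly m = Poly_Mapping.single m 1"

definition sqf_mono :: "'n set \<Rightarrow> 'n::finite monom" where
  "sqf_mono J = (\<Sum>j\<in>J. Poly_Mapping.single j 1)"

definition var :: "'n \<Rightarrow> 'n mpoly" where
  "var i = mono_poly (Poly_Mapping.single i 1)"

text \<open>The argument \<open>h\<close> embeds the coefficients into the target ring.\<close>

definition eval_in :: "(rat \<Rightarrow> 'a) \<Rightarrow> ('n::finite \<Rightarrow> 'a::comm_ring_1) \<Rightarrow> 'n mpoly \<Rightarrow> 'a" where
  "eval_in h s f =
     (\<Sum>m\<in>Poly_Mapping.keys f. h (Poly_Mapping.lookup f m) * (\<Prod>i\<in>UNIV. s i ^ Poly_Mapping.lookup m i))"

definition mp_eval :: "'n::finite mpoly \<Rightarrow> ('n \<Rightarrow> rat) \<Rightarrow> rat" where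
  "mp_eval f v = eval_in (\<lambda>c. c) v f"

definition mp_subst :: "'n::finite mpoly \<Rightarrow> ('n \<Rightarrow> 'n mpoly) \<Rightarrow> 'n mpoly" where
  "mp_subst f s = eval_in Const s f"

definition mono_dvd :: "'n monom \<Rightarrow> 'n monom \<Rightarrow> bool" where
  "mono_dvd s t \<longleftrightarrow> (\<exists>u. t = s + u)"

text \<open>\<open>prec\<close> is the strict order.\<close>

definition monomial_order :: "('n monom \<Rightarrow> 'n monom \<Rightarrow> bool) \<Rightarrow> bool" where
  "monomial_order prec \<longleftrightarrow>
     irreflp prec \<and> transp prec \<and> totalp prec \<and>
     (\<forall>m. m \<noteq> 0 \<longrightarrow> prec 0 m) \<and>
     (\<forall>s t u. prec s t \<longrightarrow> prec (s + u) (t + u))"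

definition lm :: "('n monom \<Rightarrow> 'n monom \<Rightarrow> bool) \<Rightarrow> 'n mpoly \<Rightarrow> 'n monom" where
  "lm prec f = (THE m. m \<in> Poly_Mapping.keys f \<and> (\<forall>t\<in>Poly_Mapping.keys f. t \<noteq> m \<longrightarrow> prec t m))"

text \<open>A basis may contain \<open>0\<close>, which has no leading monomial; hence the condition \<open>g \<noteq> 0\<close>.\<close>

definition groebner_basis ::
    "('n monom \<Rightarrow> 'n monom \<Rightarrow> bool) \<Rightarrow> 'n mpoly set \<Rightarrow> 'n mpoly set \<Rightarrow> bool" where
  "groebner_basis prec I G \<longleftrightarrow>
     finite G \<and> G \<subseteq> I \<and>
     (\<forall>f\<in>I. f \<noteq> 0 \<longrightarrow> (\<exists>g\<in>G. g \<noteq> 0 \<and> mono_dvd (lm prec g) (lm prec f)))"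

definition standard_monomials ::
    "('n monom \<Rightarrow> 'n monom \<Rightarrow> bool) \<Rightarrow> 'n mpoly set \<Rightarrow> 'n monom set" where
  "standard_monomials prec I = {m. \<not> (\<exists>f\<in>I. f \<noteq> 0 \<and> lm prec f = m)}"

definition vanishing_ideal :: "('n::finite \<Rightarrow> rat) set \<Rightarrow> 'n mpoly set" where
  "vanishing_ideal V = {f. \<forall>v\<in>V. mp_eval f v = 0}"

definition family_ideal :: "'n::finite set set \<Rightarrow> 'n mpoly set" where
  "family_ideal H = vanishing_ideal {indicator S | S. S \<in> H}"

definition grid :: "nat \<Rightarrow> ('n \<Rightarrow>\<^sub>0 nat) set" where
  "grid q = {v. \<forall>i. Poly_Mapping.lookup v i < q}"

text \<open>The support of a vector \<open>v\<close> is \<open>Poly_Mapping.keys v\<close>.\<close>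

definition blow_up :: "nat \<Rightarrow> 'n set set \<Rightarrow> ('n \<Rightarrow> rat) set" where
  "blow_up q F = {(\<lambda>i. of_nat (Poly_Mapping.lookup v i)) | v. v \<in> grid q \<and> Poly_Mapping.keys v \<in> F}"

definition members_above :: "'n set set \<Rightarrow> 'n set \<Rightarrow> 'n set set" where
  "members_above F J = {S \<in> F. J \<subseteq> S}"

definition grid_poly :: "nat \<Rightarrow> 'n \<Rightarrow> 'n mpoly" where
  "grid_poly q i = (\<Prod>j<q. (var i - of_nat j))"

definition step_poly :: "nat \<Rightarrow> rat poly" where
  "step_poly q = (THE p. degree p = q - 1 \<and> poly p 0 = 0 \<and> (\<forall>i\<in>{1..q - 1}. poly p (of_nat i) = 1))"

lemma step_poly_unique:
  assumes "q \<ge> 2"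
  shows "\<exists>!p :: rat poly.
    degree p = q - 1 \<and> poly p 0 = 0 \<and> (\<forall>i\<in>{1..q - 1}. poly p (of_nat i) = 1)"
proof (rule ex_ex1I)
  define r :: "rat poly" where "r = (\<Prod>i\<in>{1..q - 1}. [:- of_nat i, 1:])"
  have deg_r: "degree r = q - 1"
    unfolding r_def by (subst degree_prod_eq_sum_degree) auto
  have r0: "poly r 0 \<noteq> 0"
    by (auto simp: r_def poly_prod)
  have ri: "poly r (of_nat i) = 0" if "i \<in> {1..q - 1}" for i
    using that by (auto simp: r_def poly_prod)
  define p where "p = 1 - smult (inverse (poly r 0)) r"
  have "degree p = q - 1"
  proof -
    have "degree (- smult (inverse (poly r 0)) r) = q - 1"
      using r0 deg_r by simp
    then have "degree (1 + - smult (inverse (poly r 0)) r) = q - 1"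
      using assms by (subst degree_add_eq_right) auto
    then show ?thesis by (simp add: p_def)
  qed
  then show "\<exists>p :: rat poly. degree p = q - 1 \<and> poly p 0 = 0 \<and>
      (\<forall>i\<in>{1..q - 1}. poly p (of_nat i) = 1)"
    using r0 ri by (intro exI[of _ p]) (auto simp: p_def)
next
  fix p p' :: "rat poly"
  assume p: "degree p = q - 1 \<and> poly p 0 = 0 \<and> (\<forall>i\<in>{1..q - 1}. poly p (of_nat i) = 1)"
    and p': "degree p' = q - 1 \<and> poly p' 0 = 0 \<and> (\<forall>i\<in>{1..q - 1}. poly p' (of_nat i) = 1)"
  let ?A = "of_nat ` {..<q} :: rat set"
  have "card ?A = q"
    by (subst card_image) (auto simp: inj_on_def)
  moreover have "poly p x = poly p' x" if "x \<in> ?A" for x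
  proof -
    obtain i where i: "i < q" "x = of_nat i" using \<open>x \<in> ?A\<close> by auto
    show ?thesis
    proof (cases "i = 0")
      case False
      then have "i \<in> {1..q - 1}" using i by auto
      then show ?thesis using p p' i by auto
    qed (use p p' i in auto)
  qed
  ultimately show "p = p'"
    using p p' assms by (intro poly_eqI_degree[of ?A]) auto
qed

definition bar :: "nat \<Rightarrow> 'n::finite mpoly \<Rightarrow> 'n mpoly" where
  "bar q g = mp_subst g (\<lambda>i. poly (map_poly Const (step_poly q)) (var i))"

definition J_set :: "nat \<Rightarrow> ('n \<Rightarrow>\<^sub>0 nat) \<Rightarrow> 'n set" where
  "J_set q v = {i. 0 < Poly_Mapping.lookup v i \<and> Poly_Mapping.lookup v i < q - 1}"

definition Q_set :: "nat \<Rightarrow> ('n \<Rightarrow>\<^sub>0 nat) \<Rightarrow> 'n set" where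
  "Q_set q v = {i. Poly_Mapping.lookup v i = q - 1}"

end

theory Submission
  imports Defs "HOL-Library.Function_Algebras"
begin

text \<open>
  For a finite set of points, restricting the standard monomials of its vanishing ideal to the points
  gives a basis of the space of functions on them, so there are as many standard monomials as points.
  If no leading monomial of the proposed basis divides \<open>x\<^sup>v\<close>, then \<open>v\<close> lies in the proposed set
  \<open>S\<close> of exponents, because \<open>lm (x\<^sub>J g') = x\<^sub>J (lm g)\<^bsup>q - 1\<^esup>\<close> for the substituted polynomial \<open>g'\<close>;
  in particular \<open>S\<close> contains all standard monomials of \<open>I(F\<^sup>q)\<close>. Conversely, choosing for every
  \<open>J\<close> an injection of the standard monomials of \<open>I(F\<^sub>J)\<close> into \<open>F\<^sub>J\<close> yields an injection of \<open>S\<close>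
  into \<open>F\<^sup>q\<close>. Hence \<open>S\<close> is exactly the set of standard monomials, and the leading monomial of a
  nonzero element of the ideal, not being in \<open>S\<close>, is divisible by one from the proposed basis.
\<close>

subsection \<open>Evaluation as a ring homomorphism\<close>

lemma poly_mapping_sum_single:
  "(\<Sum>m\<in>Poly_Mapping.keys f. Poly_Mapping.single m (Poly_Mapping.lookup f m)) = f"
proof (rule poly_mapping_eqI)
  fix k
  have "(\<Sum>m\<in>Poly_Mapping.keys f. Poly_Mapping.lookup f m when m = k) = Poly_Mapping.lookup f k"
    by (simp add: when_def in_keys_iff)
  then show "Poly_Mapping.lookup (\<Sum>m\<in>Poly_Mapping.keys f. Poly_Mapping.single m (Poly_Mapping.lookup f m)) k
      = Poly_Mapping.lookup f k"
    by (simp add: lookup_sum lookup_single)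
qed

text \<open>The hypotheses make \<open>h\<close> a unital ring homomorphism, and
  \<open>eval_in h s\<close> inherits this. Evaluation at a point is the case where \<open>h\<close>
  is the identity.\<close>

context
  fixes h :: "rat \<Rightarrow> 'a::comm_ring_1"
  assumes h0: "h 0 = 0" and h1: "h 1 = 1"
    and hadd: "\<And>a b. h (a + b) = h a + h b" and hmult: "\<And>a b. h (a * b) = h a * h b"
begin

text \<open>Since \<open>h 0 = 0\<close>, extra monomials contribute nothing; sums for different
  polynomials can thus be compared over a common index set.\<close>

lemma eval_in_superset:
  assumes "finite A" "Poly_Mapping.keys f \<subseteq> A"
  shows "eval_in h s f = (\<Sum>m\<in>A. h (Poly_Mapping.lookup f m) * (\<Prod>i\<in>UNIV. s i ^ Poly_Mapping.lookup m i))"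
  unfolding eval_in_def
  by (rule sum.mono_neutral_left) (use assms in \<open>auto simp: in_keys_iff h0\<close>)

lemma eval_in_zero: "eval_in h s 0 = 0"
  by (simp add: eval_in_def)

lemma eval_in_add: "eval_in h s (f + g) = eval_in h s f + eval_in h s g"
proof -
  let ?A = "Poly_Mapping.keys f \<union> Poly_Mapping.keys g"
  have "Poly_Mapping.keys (f + g) \<subseteq> ?A"
    by (rule keys_add)
  then show ?thesis
    by (simp add: eval_in_superset[of ?A] lookup_add hadd distrib_right sum.distrib)
qed

lemma eval_in_single:
  "eval_in h s (Poly_Mapping.single m c) = h c * (\<Prod>i\<in>UNIV. s i ^ Poly_Mapping.lookup m i)"
  by (subst eval_in_superset[of "{m}"]) (auto simp: h0)

lemma eval_in_sum: "eval_in h s (sum f A) = (\<Sum>a\<in>A. eval_in h s (f a))"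
  by (induction A rule: infinite_finite_induct) (simp_all add: eval_in_zero eval_in_add)

text \<open>Both sides are bilinear, so it is enough to compare products of two single
  terms.\<close>

lemma eval_in_mult: "eval_in h s (f * g) = eval_in h s f * eval_in h s g"
proof -
  have single: "eval_in h s (Poly_Mapping.single m c * Poly_Mapping.single m' c')
      = eval_in h s (Poly_Mapping.single m c) * eval_in h s (Poly_Mapping.single m' c')" for m m' c c'
    by (simp add: mult_single eval_in_single hmult lookup_add power_add prod.distrib mult_ac)
  have "eval_in h s ((\<Sum>m\<in>A. Poly_Mapping.single m (a m)) * (\<Sum>m\<in>B. Poly_Mapping.single m (b m)))
      = eval_in h s (\<Sum>m\<in>A. Poly_Mapping.single m (a m)) * eval_in h s (\<Sum>m\<in>B. Poly_Mapping.single m (b m))"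
    for a b A B
    by (simp add: sum_product eval_in_sum single)
  from this[of "Poly_Mapping.lookup f" "Poly_Mapping.keys f" "Poly_Mapping.lookup g" "Poly_Mapping.keys g"]
  show ?thesis
    by (simp only: poly_mapping_sum_single)
qed

lemma eval_in_one: "eval_in h s 1 = 1"
  using eval_in_single[of s 0 1] by (simp add: h1)

lemma eval_in_power: "eval_in h s (f ^ k) = eval_in h s f ^ k"
  by (induction k) (simp_all add: eval_in_one eval_in_mult)

lemma eval_in_prod: "eval_in h s (prod f A) = (\<Prod>a\<in>A. eval_in h s (f a))"
  by (induction A rule: infinite_finite_induct) (simp_all add: eval_in_one eval_in_mult)

end

lemma mp_eval_zero [simp]: "mp_eval 0 v = 0"
  by (simp add: mp_eval_def eval_in_zero)

lemma mp_eval_add [simp]: "mp_eval (f + g) v = mp_eval f v + mp_eval g v"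
  by (simp add: mp_eval_def eval_in_add)

lemma mp_eval_mult [simp]: "mp_eval (f * g) v = mp_eval f v * mp_eval g v"
  by (simp add: mp_eval_def eval_in_mult)

lemma mp_eval_power [simp]: "mp_eval (f ^ k) v = mp_eval f v ^ k"
  by (simp add: mp_eval_def eval_in_power)

lemma mp_eval_sum [simp]: "mp_eval (sum f A) v = (\<Sum>a\<in>A. mp_eval (f a) v)"
  by (simp add: mp_eval_def eval_in_sum)

lemma mp_eval_prod [simp]: "mp_eval (prod f A) v = (\<Prod>a\<in>A. mp_eval (f a) v)"
  by (simp add: mp_eval_def eval_in_prod)

lemma mp_eval_single:
  "mp_eval (Poly_Mapping.single m c) v = c * (\<Prod>i\<in>UNIV. v i ^ Poly_Mapping.lookup m i)"
  by (simp add: mp_eval_def eval_in_single)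

lemma mp_eval_Const [simp]: "mp_eval (Const c) v = c"
  by (simp add: Const_def mp_eval_single)

lemma mp_eval_of_nat [simp]: "mp_eval (of_nat k) v = of_nat k"
proof -
  have "(of_nat k :: 'a mpoly) = Const (of_nat k)"
    by (simp add: Const_def)
  then show ?thesis by simp
qed

lemma mp_eval_uminus [simp]: "mp_eval (- f) v = - mp_eval f v"
  using mp_eval_add[of f "- f" v] by (simp add: eq_neg_iff_add_eq_0 add.commute)

lemma mp_eval_diff [simp]: "mp_eval (f - g) v = mp_eval f v - mp_eval g v"
  using mp_eval_add[of f "- g" v] by simp

lemma mp_eval_var [simp]: "mp_eval (var i) v = v i"
proof -
  have "(\<Prod>k\<in>UNIV. v k ^ Poly_Mapping.lookup (Poly_Mapping.single i 1) k)
      = (\<Prod>k\<in>UNIV. if k = i then v i else 1)"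
    by (rule prod.cong) (auto simp: lookup_single when_def)
  then show ?thesis
    by (simp add: var_def mono_poly_def mp_eval_single)
qed

lemma mp_eval_mono_poly: "mp_eval (mono_poly m) v = (\<Prod>i\<in>UNIV. v i ^ Poly_Mapping.lookup m i)"
  by (simp add: mono_poly_def mp_eval_single)

lemma mp_eval_subst: "mp_eval (mp_subst f s) v = mp_eval f (\<lambda>i. mp_eval (s i) v)"
  by (simp add: mp_subst_def mp_eval_def[of f] eval_in_def)

section \<open>Squarefree monomials, and divisibility read off from exponents\<close>

lemma lookup_sqf_mono: "Poly_Mapping.lookup (sqf_mono J) i = (if i \<in> J then 1 else 0)"
proof -
  have "(\<Sum>j\<in>J. 1 when j = i) = (\<Sum>j\<in>J. if j = i then 1 else (0::nat))"
    by (simp add: when_def)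
  then show ?thesis
    by (simp add: sqf_mono_def lookup_sum lookup_single)
qed

lemma inj_sqf_mono: "sqf_mono J = sqf_mono K \<Longrightarrow> J = K"
  by (metis lookup_sqf_mono one_neq_zero set_eqI)

lemma mp_eval_sqf_mono: "mp_eval (mono_poly (sqf_mono J)) v = (\<Prod>j\<in>J. v j)"
proof -
  have "(\<Prod>i\<in>UNIV. v i ^ Poly_Mapping.lookup (sqf_mono J) i) = (\<Prod>i\<in>UNIV. if i \<in> J then v i else 1)"
    by (rule prod.cong) (auto simp: lookup_sqf_mono)
  then show ?thesis
    by (simp add: mp_eval_mono_poly prod.If_cases)
qed

lemma mono_dvd_iff_lookup_le:
  "mono_dvd s t \<longleftrightarrow> (\<forall>i. Poly_Mapping.lookup s i \<le> Poly_Mapping.lookup t i)"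
proof
  assume le: "\<forall>i. Poly_Mapping.lookup s i \<le> Poly_Mapping.lookup t i"
  have "t = s + (t - s)"
    by (rule poly_mapping_eqI) (simp add: lookup_add lookup_minus le)
  then show "mono_dvd s t"
    unfolding mono_dvd_def by blast
qed (auto simp: mono_dvd_def lookup_add)

subsection \<open>Functions on a finite set of points\<close>

text \<open>Provides spans, linear independence and the bound on the size of independent sets in a
  span, for rational-valued functions.\<close>

interpretation fun_space: vector_space "\<lambda>(c::rat) (f :: 'a \<Rightarrow> rat) x. c * f x"
  by unfold_locales (auto simp: algebra_simps)

lemma fun_sum_apply: "sum f A x = (\<Sum>a\<in>A. f a x)" for f :: "'b \<Rightarrow> 'a \<Rightarrow> 'c::comm_monoid_add"
  by (induction A rule: infinite_finite_induct) auto

text \<open>Cutting off to 0 outside \<open>V\<close> makes equality of these functions mean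
  equality on \<open>V\<close>, so \<open>f\<close> is in the vanishing ideal exactly when
  \<open>values_on V f\<close> is zero.\<close>

definition values_on :: "('n::finite \<Rightarrow> rat) set \<Rightarrow> 'n mpoly \<Rightarrow> ('n \<Rightarrow> rat) \<Rightarrow> rat" where
  "values_on V f = (\<lambda>v. if v \<in> V then mp_eval f v else 0)"

definition point_fun :: "'a \<Rightarrow> 'a \<Rightarrow> rat" where
  "point_fun v = (\<lambda>x. if x = v then 1 else 0)"

lemma point_fun_apply: "point_fun v x = (if x = v then 1 else 0)"
  by (simp add: point_fun_def)

lemma values_on_expand:
  "values_on V f = (\<Sum>m\<in>Poly_Mapping.keys f. (\<lambda>x. Poly_Mapping.lookup f m * values_on V (mono_poly m) x))"
proof
  fix x
  have "mp_eval f x = (\<Sum>m\<in>Poly_Mapping.keys f. Poly_Mapping.lookup f m * mp_eval (mono_poly m) x)"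
    by (simp add: mp_eval_mono_poly mp_eval_def[of f] eval_in_def)
  then show "values_on V f x =
      (\<Sum>m\<in>Poly_Mapping.keys f. (\<lambda>x. Poly_Mapping.lookup f m * values_on V (mono_poly m) x)) x"
    by (simp add: fun_sum_apply values_on_def)
qed

lemma vanishing_ideal_if_values_on:
  assumes "\<And>x. values_on V f x = 0"
  shows "f \<in> vanishing_ideal V"
  unfolding vanishing_ideal_def
proof (intro CollectI ballI)
  fix v assume "v \<in> V"
  then show "mp_eval f v = 0"
    using assms[of v] by (simp add: values_on_def)
qed

lemma inj_on_point_fun: "inj_on point_fun V"
  by (rule inj_onI) (metis point_fun_def one_neq_zero)

lemma independent_points: "fun_space.independent (point_fun ` V)"
  unfolding fun_space.independent_explicit_finite_subsets
proof (intro allI impI ballI)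
  fix T u w
  assume T: "T \<subseteq> point_fun ` V" "finite T" and sum: "(\<Sum>w\<in>T. (\<lambda>x. u w * w x)) = 0" and w: "w \<in> T"
  obtain v where v: "w = point_fun v" using w T by auto
  \<comment> \<open>Evaluating the relation at the point \<open>v\<close> isolates the coefficient
    of \<open>w\<close>, since distinct points have distinct point functions.\<close>
  have "(\<Sum>w'\<in>T. u w' * w' v) = (\<Sum>w'\<in>T. if w' = w then u w else 0)"
  proof (rule sum.cong)
    fix w' assume "w' \<in> T"
    then obtain v' where "w' = point_fun v'" using T by auto
    then show "u w' * w' v = (if w' = w then u w else 0)"
      using v inj_on_eq_iff[OF inj_on_point_fun[of UNIV], of v v'] by (auto simp: point_fun_apply)
  qed simp
  then show "u w = 0"
    using fun_cong[OF sum, of v] w T(2) by (simp add: fun_sum_apply)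
qed

lemma values_on_in_span_points:
  assumes "finite V"
  shows "values_on V f \<in> fun_space.span (point_fun ` V)"
proof -
  have "values_on V f = (\<Sum>v\<in>V. (\<lambda>x. mp_eval f v * point_fun v x))"
  proof
    fix x
    have "(\<Sum>v\<in>V. mp_eval f v * point_fun v x) = (\<Sum>v\<in>V. if x = v then mp_eval f v else 0)"
      by (rule sum.cong) (auto simp: point_fun_def)
    then show "values_on V f x = (\<Sum>v\<in>V. (\<lambda>x. mp_eval f v * point_fun v x)) x"
      using assms by (simp add: fun_sum_apply values_on_def)
  qed
  also have "\<dots> \<in> fun_space.span (point_fun ` V)"
    by (intro fun_space.span_sum fun_space.span_scale fun_space.span_base imageI)
  finally show ?thesis .
qed

text \<open>Lagrange interpolation: each other point \<open>w\<close> differs from \<open>v\<close>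
  in some coordinate, and a normalised linear factor in that coordinate is 1 at \<open>v\<close> and
  0 at \<open>w\<close>. The product of these factors is the interpolant.\<close>

lemma interpolation:
  assumes "finite V" "v \<in> V"
  shows "\<exists>f. values_on V f = point_fun v"
proof -
  have "\<exists>g. mp_eval g v = 1 \<and> mp_eval g w = 0" if neq: "w \<noteq> v" for w
  proof -
    obtain i where i: "w i \<noteq> v i" using neq by auto
    let ?g = "Const (inverse (v i - w i)) * (var i - Const (w i))"
    have "mp_eval ?g v = 1 \<and> mp_eval ?g w = 0" using i by simp
    then show ?thesis by blast
  qed
  then obtain g where g: "\<And>w. w \<noteq> v \<Longrightarrow> mp_eval (g w) v = 1 \<and> mp_eval (g w) w = 0"
    by metis
  have "values_on V (\<Prod>w\<in>V - {v}. g w) = point_fun v"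
  proof
    fix x
    have "(\<Prod>w\<in>V - {v}. mp_eval (g w) v) = 1"
      using g by (intro prod.neutral) auto
    moreover have "(\<Prod>w\<in>V - {v}. mp_eval (g w) x) = 0" if "x \<in> V" "x \<noteq> v"
      using that assms(1) g by (intro prod_zero) auto
    ultimately show "values_on V (\<Prod>w\<in>V - {v}. g w) x = point_fun v x"
      using assms(2) by (auto simp: values_on_def point_fun_def)
  qed
  then show ?thesis by blast
qed

subsection \<open>The blow-up of a set family\<close>

lemma var_power: "var i ^ k = mono_poly (Poly_Mapping.single i k)"
  by (induction k) (simp_all add: var_def mono_poly_def mult_single flip: single_add)

lemma poly_map_Const:
  "poly (map_poly Const p) (x :: 'n mpoly) = (\<Sum>k\<le>degree p. Const (coeff p k) * x ^ k)"
proof -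
  have "(Const c :: 'n mpoly) = 0 \<longleftrightarrow> c = 0" for c :: rat
    by (metis Const_def lookup_single_eq lookup_zero single_zero)
  then show ?thesis
    by (simp add: poly_altdef degree_map_poly coeff_map_poly)
qed

lemma step_poly_props:
  assumes "q \<ge> 2"
  shows "degree (step_poly q) = q - 1" and "poly (step_poly q) 0 = 0"
    and "i \<in> {1..q - 1} \<Longrightarrow> poly (step_poly q) (of_nat i) = 1"
  using theI'[OF step_poly_unique[OF assms]] by (auto simp: step_poly_def)

lemma mp_eval_bar: "mp_eval (bar q g) v = mp_eval g (\<lambda>i. poly (step_poly q) (v i))"
  by (simp add: bar_def mp_eval_subst poly_map_Const poly_altdef[of "step_poly q"])

text \<open>On grid entries the step polynomial fixes 0 and sends everything else to 1, so it turns
  a vector into the characteristic vector of its support. This carries vanishing on a set family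
  over to its blow-up.\<close>

lemma mp_eval_bar_grid:
  assumes "q \<ge> 2" "v \<in> grid q"
  shows "mp_eval (bar q g) (\<lambda>i. of_nat (Poly_Mapping.lookup v i)) = mp_eval g (indicator (Poly_Mapping.keys v))"
proof -
  have "poly (step_poly q) (of_nat (Poly_Mapping.lookup v i)) = indicator (Poly_Mapping.keys v) i" for i
  proof (cases "Poly_Mapping.lookup v i = 0")
    case True
    then show ?thesis
      by (simp add: step_poly_props[OF assms(1)] in_keys_iff)
  next
    case False
    moreover have "Poly_Mapping.lookup v i < q"
      using assms(2) by (simp add: grid_def)
    ultimately have "Poly_Mapping.lookup v i \<in> {1..q - 1}"
      by auto
    with False show ?thesis
      by (simp add: step_poly_props(3)[OF assms(1)] in_keys_iff)
  qed
  then show ?thesis by (simp add: mp_eval_bar)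
qed

section \<open>Points of the blow-up and polynomials vanishing there\<close>

lemma finite_grid: "finite (grid q :: ('n::finite \<Rightarrow>\<^sub>0 nat) set)"
proof -
  have "Poly_Mapping.lookup ` (grid q :: ('n \<Rightarrow>\<^sub>0 nat) set) \<subseteq> {f. range f \<subseteq> {..<q}}"
    by (auto simp: grid_def)
  moreover have "finite {f :: 'n \<Rightarrow> nat. range f \<subseteq> {..<q}}"
    using finite_set_of_finite_funs[of "UNIV :: 'n set" "{..<q}"] by (simp add: image_subset_iff)
  ultimately have "finite (Poly_Mapping.lookup ` (grid q :: ('n \<Rightarrow>\<^sub>0 nat) set))"
    by (rule finite_subset)
  then show ?thesis
    by (rule finite_imageD) (auto intro: inj_onI poly_mapping_eqI)
qed

text \<open>The points of the blow-up before the cast to rational vectors; the injection argument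
  below counts these.\<close>

definition grid_support :: "nat \<Rightarrow> 'n set set \<Rightarrow> ('n \<Rightarrow>\<^sub>0 nat) set" where
  "grid_support q F = {v \<in> grid q. Poly_Mapping.keys v \<in> F}"

lemma finite_card_blow_up:
  fixes F :: "'n::finite set set"
  shows "finite (blow_up q F)" and "card (blow_up q F) = card (grid_support q F)"
proof -
  let ?e = "\<lambda>(v :: 'n \<Rightarrow>\<^sub>0 nat) i. of_nat (Poly_Mapping.lookup v i) :: rat"
  have eq: "blow_up q F = ?e ` grid_support q F"
    by (auto simp: blow_up_def grid_support_def)
  have "finite (grid_support q F)"
    unfolding grid_support_def by (rule finite_subset[OF _ finite_grid[of q]]) auto
  then show "finite (blow_up q F)" by (simp add: eq)
  have "inj_on ?e (grid_support q F)"
    by (rule inj_onI, rule poly_mapping_eqI) (metis of_nat_eq_iff)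
  then show "card (blow_up q F) = card (grid_support q F)"
    by (simp add: eq card_image)
qed

lemma blow_upE:
  assumes "x \<in> blow_up q F"
  obtains v where "v \<in> grid q" "Poly_Mapping.keys v \<in> F" "x = (\<lambda>i. of_nat (Poly_Mapping.lookup v i))"
  using assms by (auto simp: blow_up_def)

lemma grid_poly_in_ideal: "grid_poly q i \<in> vanishing_ideal (blow_up q F)"
  unfolding vanishing_ideal_def
proof (intro CollectI ballI)
  fix x assume "x \<in> blow_up q F"
  then obtain v where v: "v \<in> grid q" "x = (\<lambda>i. of_nat (Poly_Mapping.lookup v i))"
    by (rule blow_upE)
  then have "Poly_Mapping.lookup v i < q" by (simp add: grid_def)
  then have "\<exists>j<q. (of_nat (Poly_Mapping.lookup v i) :: rat) - of_nat j = 0" by auto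
  then show "mp_eval (grid_poly q i) x = 0"
    by (auto simp: grid_poly_def v(2) intro!: prod_zero)
qed

text \<open>The monomial of \<open>J\<close> vanishes at every point whose support misses an element
  of \<open>J\<close>, so the cofactor \<open>h\<close> has to vanish only at the remaining points.
  It is later \<open>bar q g\<close>, or 1 when no points remain.\<close>

lemma mono_times_in_ideal:
  assumes "\<And>v. v \<in> grid q \<Longrightarrow> Poly_Mapping.keys v \<in> members_above F J \<Longrightarrow>
      mp_eval h (\<lambda>i. of_nat (Poly_Mapping.lookup v i)) = 0"
  shows "mono_poly (sqf_mono J) * h \<in> vanishing_ideal (blow_up q F)"
  unfolding vanishing_ideal_def
proof (intro CollectI ballI)
  fix x assume "x \<in> blow_up q F"
  then obtain v where v: "v \<in> grid q" "Poly_Mapping.keys v \<in> F" "x = (\<lambda>i. of_nat (Poly_Mapping.lookup v i))"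
    by (rule blow_upE)
  show "mp_eval (mono_poly (sqf_mono J) * h) x = 0"
  proof (cases "J \<subseteq> Poly_Mapping.keys v")
    case True
    then show ?thesis using assms v by (simp add: members_above_def)
  next
    case False
    then obtain j where "j \<in> J" "j \<notin> Poly_Mapping.keys v" by blast
    then have "j \<in> J" "x j = 0" by (simp_all add: v(3) in_keys_iff)
    then have "(\<Prod>j\<in>J. x j) = 0" by (intro prod_zero) auto
    then show ?thesis by (simp add: mp_eval_sqf_mono)
  qed
qed

lemma mono_bar_in_ideal:
  assumes "q \<ge> 2" "g \<in> family_ideal (members_above F J)"
  shows "mono_poly (sqf_mono J) * bar q g \<in> vanishing_ideal (blow_up q F)"
  using assms by (intro mono_times_in_ideal)
    (auto simp: mp_eval_bar_grid family_ideal_def vanishing_ideal_def)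

lemma mono_in_ideal:
  assumes "members_above F J = {}"
  shows "mono_poly (sqf_mono J) \<in> vanishing_ideal (blow_up q F)"
  using mono_times_in_ideal[of q F J 1] assms by simp

text \<open>The injection into the grid keeps the entries of \<open>v\<close> on \<open>J(v)\<close> and replaces the standard monomial
  \<open>x\<^bsub>Q(v)\<^esub>\<close> of \<open>I(F\<^bsub>J(v)\<^esub>)\<close> by the member of \<open>F\<^bsub>J(v)\<^esub>\<close> that corresponds to it under
  an arbitrary injection \<open>h (J(v))\<close>; that member is the support of the image of \<open>v\<close>.\<close>

lemma card_candidates_le:
  fixes F :: "'n::finite set set" and S :: "'n set \<Rightarrow> 'n monom set"
  assumes q: "q \<ge> 2"
    and fin: "\<And>J. finite (S J)"
    and card_le: "\<And>J. card (S J) \<le> card (members_above F J)"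
  shows "card {v \<in> grid q. members_above F (J_set q v) \<noteq> {} \<and> sqf_mono (Q_set q v) \<in> S (J_set q v)}
    \<le> card (grid_support q F)" (is "card ?C \<le> _")
proof -
  have "\<exists>h. inj_on h (S J) \<and> h ` S J \<subseteq> members_above F J" for J
    using card_le by (subst inj_on_iff_card_le) (simp_all add: fin)
  then obtain h where inj: "\<And>J. inj_on (h J) (S J)" and range: "\<And>J. h J ` S J \<subseteq> members_above F J"
    by metis
  define A where "A v = h (J_set q v) (sqf_mono (Q_set q v))" for v :: "'n \<Rightarrow>\<^sub>0 nat"
  define w where "w v = Abs_poly_mapping (\<lambda>i. if i \<in> J_set q v then Poly_Mapping.lookup v i
      else if i \<in> A v then q - 1 else 0)" for v :: "'n \<Rightarrow>\<^sub>0 nat"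
  have w: "Poly_Mapping.lookup (w v) i = (if i \<in> J_set q v then Poly_Mapping.lookup v i
      else if i \<in> A v then q - 1 else 0)" for v i
    unfolding w_def by (subst lookup_Abs_poly_mapping) auto
  have A: "A v \<in> F" "J_set q v \<subseteq> A v" if "v \<in> ?C" for v
    using range[of "J_set q v"] that by (auto simp: A_def members_above_def)
  \<comment> \<open>Entries put outside \<open>J_set q v\<close> are 0 or \<open>q - 1\<close>, the
    two extreme values that \<open>J_set\<close> excludes, so the image still determines
    \<open>J_set q v\<close>.\<close>
  have J_w: "J_set q (w v) = J_set q v" for v
    by (auto simp: J_set_def[of q "w v"] w) (auto simp: J_set_def)
  have keys_w: "Poly_Mapping.keys (w v) = A v" if "v \<in> ?C" for v
    using A(2)[OF that] q by (auto simp: in_keys_iff w J_set_def split: if_splits)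
  have "inj_on w ?C"
  proof (rule inj_onI)
    fix u v
    assume u: "u \<in> ?C" and v: "v \<in> ?C" and eq: "w u = w v"
    \<comment> \<open>Equal images give equal \<open>J_set\<close>, then equal supports
      \<open>A\<close>, then equal \<open>Q_set\<close> by injectivity of the common
      \<open>h\<close>.\<close>
    have J: "J_set q u = J_set q v" using J_w[of u] J_w[of v] eq by simp
    have "A u = A v" using keys_w[OF u] keys_w[OF v] eq by simp
    then have "sqf_mono (Q_set q u) = sqf_mono (Q_set q v)"
      using inj_onD[OF inj[of "J_set q v"]] u v J by (simp add: A_def)
    then have Q: "Q_set q u = Q_set q v" by (rule inj_sqf_mono)
    show "u = v"
    proof (rule poly_mapping_eqI)
      fix i
      \<comment> \<open>Entries in \<open>J_set\<close> are copied by \<open>w\<close>, those in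
        \<open>Q_set\<close> are \<open>q - 1\<close>, and all other entries of a grid vector are
        0.\<close>
      consider "i \<in> J_set q v" | "i \<in> Q_set q v" | "i \<notin> J_set q v" "i \<notin> Q_set q v" by blast
      then show "Poly_Mapping.lookup u i = Poly_Mapping.lookup v i"
      proof cases
        case 1
        then show ?thesis using w[of u i] w[of v i] eq J by simp
      next
        case 2
        then show ?thesis using Q by (auto simp: Q_set_def)
      next
        case 3
        have "Poly_Mapping.lookup x i = 0"
          if "x \<in> grid q" "i \<notin> J_set q x" "i \<notin> Q_set q x" for x :: "'n \<Rightarrow>\<^sub>0 nat"
        proof -
          have "Poly_Mapping.lookup x i < q"
            using that(1) by (simp add: grid_def)
          then show ?thesis
            using that(2,3) by (auto simp: J_set_def Q_set_def)
        qed
        then show ?thesis using 3 u v J Q by simp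
      qed
    qed
  qed
  moreover have "w ` ?C \<subseteq> grid_support q F"
  proof
    fix x assume "x \<in> w ` ?C"
    then obtain v where v: "v \<in> ?C" "x = w v" by blast
    have "Poly_Mapping.lookup (w v) i < q" for i
      using v(1) q by (auto simp: w grid_def)
    then show "x \<in> grid_support q F"
      using v A keys_w by (simp add: grid_support_def grid_def)
  qed
  moreover have "finite (grid_support q F)"
    unfolding grid_support_def by (rule finite_subset[OF _ finite_grid[of q]]) auto
  ultimately show ?thesis
    by (rule card_inj_on_le)
qed

subsection \<open>Leading monomials\<close>

text \<open>An explicit leading term with a strictly smaller remainder passes through sums and
  products more easily than \<open>lm\<close>. For a monomial order it also forces \<open>f\<close>
  to be nonzero.\<close>

definition has_lm :: "('n monom \<Rightarrow> 'n monom \<Rightarrow> bool) \<Rightarrow> 'n mpoly \<Rightarrow> 'n monom \<Rightarrow> bool" where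
  "has_lm prec f m \<longleftrightarrow>
     (\<exists>c f'. c \<noteq> 0 \<and> f = Poly_Mapping.single m c + f' \<and> (\<forall>t\<in>Poly_Mapping.keys f'. prec t m))"

lemma keys_sum_subset: "Poly_Mapping.keys (sum f A) \<subseteq> (\<Union>a\<in>A. Poly_Mapping.keys (f a))"
proof (induction A rule: infinite_finite_induct)
  case (insert a A)
  then show ?case using keys_add[of "f a" "sum f A"] by auto
qed auto

section \<open>Dickson's lemma for sequences of monomials\<close>

lemma nat_seq_incseq_subseq:
  fixes s :: "nat \<Rightarrow> nat"
  obtains r where "strict_mono r" "incseq (s \<circ> r)"
proof -
  obtain f where f: "strict_mono f" "monoseq (\<lambda>n. s (f n))"
    using seq_monosub by blast
  show ?thesis
  proof (cases "incseq (\<lambda>n. s (f n))")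
    case True
    then show ?thesis using f that[of f] by (simp add: comp_def)
  next
    case False
    then have dec: "decseq (\<lambda>n. s (f n))"
      using f by (simp add: monoseq_iff)
    \<comment> \<open>A nonincreasing sequence of naturals is constant, hence nondecreasing, from
      the point where it attains its minimum \<open>k\<close>.\<close>
    define k where "k = (LEAST x. x \<in> range (\<lambda>n. s (f n)))"
    have "k \<in> range (\<lambda>n. s (f n))"
      unfolding k_def by (rule LeastI[of _ "s (f 0)"]) auto
    then obtain N where N: "s (f N) = k" by auto
    have "s (f n) = k" if "n \<ge> N" for n
    proof (rule antisym)
      show "s (f n) \<le> k" using decseqD[OF dec that] N by simp
      show "k \<le> s (f n)" unfolding k_def by (rule Least_le) auto
    qed
    then have "incseq (s \<circ> (\<lambda>n. f (N + n)))"
      by (simp add: incseq_def)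
    moreover have "strict_mono (\<lambda>n. f (N + n))"
      using f(1) by (simp add: strict_mono_def)
    ultimately show ?thesis using that by blast
  qed
qed

text \<open>Coordinates are treated one after another; a further subsequence keeps the monotonicity
  already achieved in the earlier ones.\<close>

lemma dickson_subseq:
  fixes s :: "nat \<Rightarrow> 'n::finite monom"
  obtains r where "strict_mono r" "\<And>i. incseq (\<lambda>k. Poly_Mapping.lookup (s (r k)) i)"
proof -
  have "\<exists>r. strict_mono r \<and> (\<forall>i\<in>A. incseq (\<lambda>k. Poly_Mapping.lookup (s (r k)) i))" if "finite A" for A :: "'n set"
    using that
  proof induction
    case empty
    then show ?case by (auto intro: exI[of _ id] simp: strict_mono_def)
  next
    case (insert a A)
    then obtain r where r: "strict_mono r" "\<forall>i\<in>A. incseq (\<lambda>k. Poly_Mapping.lookup (s (r k)) i)"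
      by blast
    obtain r' where r': "strict_mono r'" "incseq ((\<lambda>k. Poly_Mapping.lookup (s (r k)) a) \<circ> r')"
      using nat_seq_incseq_subseq by blast
    have "incseq (\<lambda>k. Poly_Mapping.lookup (s (r (r' k))) i)" if "i \<in> insert a A" for i
    proof (cases "i = a")
      case True
      then show ?thesis using r' by (simp add: comp_def)
    next
      case False
      then have "incseq (\<lambda>k. Poly_Mapping.lookup (s (r k)) i)" using r that by auto
      then show ?thesis
        using strict_mono_leD[OF r'(1)] by (simp add: incseq_def)
    qed
    then show ?case
      using strict_mono_o[OF r(1) r'(1)] by (intro exI[of _ "r \<circ> r'"]) (simp add: comp_def)
  qed
  from this[of UNIV] show ?thesis using that by auto
qed

section \<open>Monomial orders and their well-foundedness\<close>

context
  fixes prec :: "'n::finite monom \<Rightarrow> 'n monom \<Rightarrow> bool"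
  assumes order: "monomial_order prec"
begin

lemma prec_irrefl: "\<not> prec m m"
  using order by (simp add: monomial_order_def irreflp_def)

lemma prec_trans: "prec a b \<Longrightarrow> prec b c \<Longrightarrow> prec a c"
  using order unfolding monomial_order_def by (meson transpE)

lemma prec_total: "a \<noteq> b \<Longrightarrow> prec a b \<or> prec b a"
  using order by (simp add: monomial_order_def totalp_on_def)

lemma prec_zero: "m \<noteq> 0 \<Longrightarrow> prec 0 m"
  using order by (simp add: monomial_order_def)

lemma prec_add_right: "prec s t \<Longrightarrow> prec (s + u) (t + u)"
  using order by (simp add: monomial_order_def)

lemma prec_add_left: "prec s t \<Longrightarrow> prec (u + s) (u + t)"
  using prec_add_right[of s t u] by (simp add: add.commute)

lemma prec_add_mono: "prec s t \<Longrightarrow> prec s' t' \<Longrightarrow> prec (s + s') (t + t')"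
  using prec_trans[OF prec_add_right prec_add_left] .

text \<open>A monomial order extends divisibility, since 0 is its least element and it respects
  addition.\<close>

lemma mono_dvd_imp_not_prec: "mono_dvd s t \<Longrightarrow> \<not> prec t s"
proof -
  assume "mono_dvd s t"
  then obtain u where "t = s + u" by (auto simp: mono_dvd_def)
  then have "s = t \<or> prec s t"
    using prec_add_left[OF prec_zero, of u s] by (cases "u = 0") auto
  then show ?thesis
    using prec_irrefl prec_trans by blast
qed

text \<open>By Dickson's lemma an infinite descending chain would contain an earlier term dividing a
  later, smaller one. Well-foundedness drives the reduction of arbitrary monomials to standard
  ones.\<close>

lemma wfp_prec: "wfp prec"
proof (rule ccontr)
  assume "\<not> wfp prec"
  then obtain s where s: "\<And>k. prec (s (Suc k)) (s k)"
    by (auto simp: wfp_def wf_iff_no_infinite_down_chain)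
  have less: "prec (s k) (s j)" if "j < k" for j k
    using that by (induction k) (auto simp: less_Suc_eq intro: prec_trans s)
  obtain r where r: "strict_mono r" "\<And>i. incseq (\<lambda>k. Poly_Mapping.lookup (s (r k)) i)"
    using dickson_subseq by blast
  have "mono_dvd (s (r 0)) (s (r 1))"
    using r(2) by (simp add: mono_dvd_iff_lookup_le incseq_def)
  moreover have "prec (s (r 1)) (s (r 0))"
    using r(1) by (intro less) (simp add: strict_mono_def)
  ultimately show False
    using mono_dvd_imp_not_prec by blast
qed

section \<open>Leading monomials of products, powers and sums\<close>

lemma ex_has_lm:
  assumes "f \<noteq> 0"
  shows "\<exists>m. has_lm prec f m"
proof -
  have "\<exists>m\<in>A. \<forall>t\<in>A. t \<noteq> m \<longrightarrow> prec t m" if "finite A" "A \<noteq> {}" for A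
    using that
  proof (induction rule: finite_ne_induct)
    case (insert a A)
    then obtain m where m: "m \<in> A" "\<forall>t\<in>A. t \<noteq> m \<longrightarrow> prec t m" by blast
    then show ?case
      using prec_total[of a m] insert.hyps
      by (metis insert_iff prec_trans)
  qed auto
  from this[of "Poly_Mapping.keys f"] assms
  obtain m where m: "m \<in> Poly_Mapping.keys f" "\<forall>t\<in>Poly_Mapping.keys f. t \<noteq> m \<longrightarrow> prec t m"
    by auto
  define f' where "f' = f - Poly_Mapping.single m (Poly_Mapping.lookup f m)"
  have "prec t m" if "t \<in> Poly_Mapping.keys f'" for t
    using that m by (cases "t = m") (auto simp: f'_def in_keys_iff lookup_minus lookup_single)
  moreover have "f = Poly_Mapping.single m (Poly_Mapping.lookup f m) + f'"
    by (simp add: f'_def)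
  ultimately show ?thesis
    using m(1) unfolding has_lm_def in_keys_iff by blast
qed

lemma has_lm_in_keys: "has_lm prec f m \<Longrightarrow> m \<in> Poly_Mapping.keys f"
  using prec_irrefl[of m] by (auto simp: has_lm_def in_keys_iff lookup_add)

lemma has_lm_nonzero: "has_lm prec f m \<Longrightarrow> f \<noteq> 0"
  using has_lm_in_keys by fastforce

lemma has_lm_prec:
  assumes "has_lm prec f m" "t \<in> Poly_Mapping.keys f" "t \<noteq> m"
  shows "prec t m"
  using assms by (auto simp: has_lm_def in_keys_iff lookup_add lookup_single)

lemma lm_eq:
  assumes "has_lm prec f m"
  shows "lm prec f = m"
  unfolding lm_def
proof (rule the_equality)
  show "m \<in> Poly_Mapping.keys f \<and> (\<forall>t\<in>Poly_Mapping.keys f. t \<noteq> m \<longrightarrow> prec t m)"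
    using assms has_lm_in_keys has_lm_prec by blast
  then show "m' = m" if "m' \<in> Poly_Mapping.keys f \<and> (\<forall>t\<in>Poly_Mapping.keys f. t \<noteq> m' \<longrightarrow> prec t m')" for m'
    using that prec_irrefl prec_trans by metis
qed

lemma has_lm_lm: "f \<noteq> 0 \<Longrightarrow> has_lm prec f (lm prec f)"
  using ex_has_lm lm_eq by auto

lemma has_lm_mono_poly: "has_lm prec (mono_poly m) m"
  unfolding has_lm_def mono_poly_def by (intro exI[of _ 1] exI[of _ 0]) auto

text \<open>The leading coefficients multiply to a nonzero rational, and compatibility of the order
  with addition puts the three remaining products strictly below \<open>m + n\<close>.\<close>

lemma has_lm_mult:
  assumes "has_lm prec f m" "has_lm prec g n"
  shows "has_lm prec (f * g) (m + n)"
proof -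
  obtain c f' where f: "c \<noteq> 0" "f = Poly_Mapping.single m c + f'" "\<forall>t\<in>Poly_Mapping.keys f'. prec t m"
    using assms(1) by (auto simp: has_lm_def)
  obtain d g' where g: "d \<noteq> 0" "g = Poly_Mapping.single n d + g'" "\<forall>t\<in>Poly_Mapping.keys g'. prec t n"
    using assms(2) by (auto simp: has_lm_def)
  let ?r = "f' * Poly_Mapping.single n d + (Poly_Mapping.single m c * g' + f' * g')"
  have "prec t (m + n)" if t: "t \<in> Poly_Mapping.keys ?r" for t
  proof -
    have "t \<in> Poly_Mapping.keys (f' * Poly_Mapping.single n d) \<union>
        Poly_Mapping.keys (Poly_Mapping.single m c * g') \<union> Poly_Mapping.keys (f' * g')"
      using t keys_add[of "f' * Poly_Mapping.single n d" "Poly_Mapping.single m c * g' + f' * g'"]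
        keys_add[of "Poly_Mapping.single m c * g'" "f' * g'"] by blast
    then obtain a b where t: "t = a + b" and
      ab: "a \<in> Poly_Mapping.keys f' \<and> b \<in> Poly_Mapping.keys (Poly_Mapping.single n d) \<or>
        a \<in> Poly_Mapping.keys (Poly_Mapping.single m c) \<and> b \<in> Poly_Mapping.keys g' \<or>
        a \<in> Poly_Mapping.keys f' \<and> b \<in> Poly_Mapping.keys g'"
      using keys_mult[of f' "Poly_Mapping.single n d"] keys_mult[of "Poly_Mapping.single m c" g']
        keys_mult[of f' g'] by blast
    from ab show ?thesis
      unfolding t using f(1,3) g(1,3)
      by (auto intro: prec_add_left prec_add_right prec_add_mono)
  qed
  moreover have "f * g = Poly_Mapping.single (m + n) (c * d) + ?r"
    by (simp add: f(2) g(2) algebra_simps mult_single)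
  moreover have "c * d \<noteq> 0" using f g by simp
  ultimately show ?thesis unfolding has_lm_def by blast
qed

lemma has_lm_one: "has_lm prec 1 0"
  using has_lm_mono_poly[of 0] by (simp add: mono_poly_def)

lemma has_lm_prod:
  "(\<And>a. a \<in> A \<Longrightarrow> has_lm prec (f a) (m a)) \<Longrightarrow> has_lm prec (prod f A) (sum m A)"
  by (induction A rule: infinite_finite_induct) (auto intro: has_lm_one has_lm_mult)

lemma has_lm_power: "has_lm prec f m \<Longrightarrow> has_lm prec (f ^ k) (\<Sum>j<k. m)"
  using has_lm_prod[of "{..<k}" "\<lambda>_. f" "\<lambda>_. m"] by (simp add: prod_constant)

lemma has_lm_add:
  assumes "has_lm prec f m" "\<And>t. t \<in> Poly_Mapping.keys g \<Longrightarrow> prec t m"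
  shows "has_lm prec (f + g) m"
proof -
  obtain c f' where f: "c \<noteq> 0" "f = Poly_Mapping.single m c + f'" "\<forall>t\<in>Poly_Mapping.keys f'. prec t m"
    using assms(1) by (auto simp: has_lm_def)
  have "\<forall>t\<in>Poly_Mapping.keys (f' + g). prec t m"
    using f(3) assms(2) keys_add[of f' g] by blast
  then show ?thesis
    unfolding has_lm_def using f(1,2) by (metis add.assoc)
qed

text \<open>The summand at \<open>a\<close> dominates all the others, so its leading term cannot
  cancel.\<close>

lemma has_lm_sum:
  assumes "finite A" "a \<in> A" "has_lm prec (f a) m"
    and "\<And>b t. b \<in> A \<Longrightarrow> b \<noteq> a \<Longrightarrow> t \<in> Poly_Mapping.keys (f b) \<Longrightarrow> prec t m"
  shows "has_lm prec (sum f A) m"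
proof -
  have "has_lm prec (f a + sum f (A - {a})) m"
    using assms(3)
  proof (rule has_lm_add)
    fix t
    assume "t \<in> Poly_Mapping.keys (sum f (A - {a}))"
    then obtain b where "b \<in> A - {a}" "t \<in> Poly_Mapping.keys (f b)"
      using keys_sum_subset[of f "A - {a}"] by blast
    then show "prec t m" using assms(4) by auto
  qed
  then show ?thesis
    using assms(1,2) by (simp add: sum.remove)
qed

text \<open>Equal powers of monomials keep the strict order; for \<open>r = 0\<close> the two sides
  would coincide.\<close>

lemma prec_sum_const: "prec s t \<Longrightarrow> r > 0 \<Longrightarrow> prec (\<Sum>j<r. s) (\<Sum>j<r. t)" for r :: nat
proof (induction r)
  case (Suc r)
  then show ?case
    by (cases "r = 0") (auto intro: prec_add_mono)
qed simp

subsection \<open>Standard monomials of a finite set of points\<close>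

lemma lm_ideal_multiple:
  assumes "f \<in> vanishing_ideal V" "f \<noteq> 0" "mono_dvd (lm prec f) m"
  shows "m \<notin> standard_monomials prec (vanishing_ideal V)"
proof -
  obtain u where u: "m = u + lm prec f"
    using assms(3) by (auto simp: mono_dvd_def add.commute)
  have "has_lm prec (mono_poly u * f) m"
    unfolding u by (intro has_lm_mult has_lm_mono_poly has_lm_lm assms(2))
  moreover have "mono_poly u * f \<in> vanishing_ideal V"
    using assms(1) by (simp add: vanishing_ideal_def)
  ultimately show ?thesis
    unfolding standard_monomials_def using has_lm_nonzero lm_eq by blast
qed

text \<open>The leading monomial of a nonzero such \<open>f\<close> would be standard as one of its
  keys and nonstandard as a leading monomial of the ideal.\<close>

lemma vanishing_standard_eq_0:
  assumes "f \<in> vanishing_ideal V" "Poly_Mapping.keys f \<subseteq> standard_monomials prec (vanishing_ideal V)"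
  shows "f = 0"
  using assms has_lm_in_keys[OF has_lm_lm] by (auto simp: standard_monomials_def)

lemma inj_on_values_on:
  "inj_on (\<lambda>m. values_on V (mono_poly m)) (standard_monomials prec (vanishing_ideal V))"
proof (rule inj_onI)
  fix m n
  assume m: "m \<in> standard_monomials prec (vanishing_ideal V)"
    and n: "n \<in> standard_monomials prec (vanishing_ideal V)"
    and eq: "values_on V (mono_poly m) = values_on V (mono_poly n)"
  let ?f = "mono_poly m - mono_poly n"
  have "?f \<in> vanishing_ideal V"
    unfolding vanishing_ideal_def
  proof (intro CollectI ballI)
    fix v assume "v \<in> V"
    then show "mp_eval ?f v = 0"
      using fun_cong[OF eq, of v] by (simp add: values_on_def)
  qed
  moreover have "Poly_Mapping.keys ?f \<subseteq> standard_monomials prec (vanishing_ideal V)"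
    using m n keys_diff[of "mono_poly m" "mono_poly n"] by (auto simp: mono_poly_def)
  ultimately have "?f = 0"
    by (rule vanishing_standard_eq_0)
  then have "Poly_Mapping.lookup (mono_poly n) m = Poly_Mapping.lookup (mono_poly m) m"
    by simp
  then show "m = n"
    by (auto simp: mono_poly_def lookup_single when_def split: if_splits)
qed

text \<open>A linear relation between the restrictions is a polynomial in standard monomials that
  vanishes on \<open>V\<close>, hence 0.\<close>

lemma independent_values_on_standard:
  "fun_space.independent ((\<lambda>m. values_on V (mono_poly m)) ` standard_monomials prec (vanishing_ideal V))"
    (is "fun_space.independent (?\<phi> ` ?S)")
  unfolding fun_space.independent_explicit_finite_subsets
proof (intro allI impI)
  fix T u
  assume T: "T \<subseteq> ?\<phi> ` ?S" "finite T" and sum: "(\<Sum>w\<in>T. (\<lambda>x. u w * w x)) = 0"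
  obtain B where B: "B \<subseteq> ?S" "finite B" "T = ?\<phi> ` B"
    using T finite_subset_image by metis
  \<comment> \<open>The coefficients \<open>u\<close> are indexed by functions; injectivity of the
    restriction lets them be read as coefficients of monomials.\<close>
  define f where "f = (\<Sum>m\<in>B. Poly_Mapping.single m (u (?\<phi> m)))"
  have "inj_on ?\<phi> B"
    using inj_on_values_on B(1) by (rule inj_on_subset)
  then have "(\<Sum>m\<in>B. u (?\<phi> m) * ?\<phi> m x) = 0" for x
    using fun_cong[OF sum, of x] B(3) by (simp add: sum.reindex fun_sum_apply)
  moreover have "values_on V f x = (\<Sum>m\<in>B. u (?\<phi> m) * ?\<phi> m x)" for x
    by (simp add: f_def values_on_def[of V _] mp_eval_single mp_eval_mono_poly)
  ultimately have "values_on V f x = 0" for x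
    by simp
  then have "f \<in> vanishing_ideal V"
    by (rule vanishing_ideal_if_values_on)
  moreover have "Poly_Mapping.keys f \<subseteq> ?S"
  proof
    fix t assume "t \<in> Poly_Mapping.keys f"
    then obtain m where "m \<in> B" "t \<in> Poly_Mapping.keys (Poly_Mapping.single m (u (?\<phi> m)))"
      using keys_sum_subset[of "\<lambda>m. Poly_Mapping.single m (u (?\<phi> m))" B] unfolding f_def by blast
    then show "t \<in> ?S" using B(1) by (auto split: if_splits)
  qed
  ultimately have f0: "f = 0"
    by (rule vanishing_standard_eq_0)
  show "\<forall>w\<in>T. u w = 0"
  proof
    fix w assume w: "w \<in> T"
    obtain m where m: "m \<in> B" "w = ?\<phi> m"
      using w B(3) by auto
    have "u (?\<phi> m) = Poly_Mapping.lookup f m"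
      using B(2) m(1) by (simp add: f_def lookup_sum lookup_single when_def)
    also have "\<dots> = 0"
      unfolding f0 by (rule lookup_zero)
    finally show "u w = 0"
      unfolding m(2) .
  qed
qed

text \<open>Well-founded induction on monomials: a nonstandard one is the leading monomial of some
  \<open>f\<close> in the ideal, and the vanishing of \<open>f\<close> on \<open>V\<close> expresses
  it there through smaller monomials.\<close>

lemma values_on_in_span_standard:
  "values_on V f \<in> fun_space.span ((\<lambda>m. values_on V (mono_poly m)) ` standard_monomials prec (vanishing_ideal V))"
    (is "_ \<in> fun_space.span (?\<phi> ` ?S)")
proof -
  have poly: "values_on V f \<in> fun_space.span (?\<phi> ` ?S)"
    if "\<And>t. t \<in> Poly_Mapping.keys f \<Longrightarrow> ?\<phi> t \<in> fun_space.span (?\<phi> ` ?S)" for f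
    unfolding values_on_expand[of V f]
    by (intro fun_space.span_sum fun_space.span_scale that)
  have mono: "?\<phi> m \<in> fun_space.span (?\<phi> ` ?S)" for m
    using wfp_prec
  proof (induction m rule: wfp_induct_rule)
    case (less m)
    show ?case
    proof (cases "m \<in> ?S")
      case True
      then show ?thesis by (intro fun_space.span_base imageI)
    next
      case False
      then obtain f where f: "f \<in> vanishing_ideal V" "f \<noteq> 0" "lm prec f = m"
        by (auto simp: standard_monomials_def)
      then obtain c r where r: "c \<noteq> 0" "f = Poly_Mapping.single m c + r"
          "\<forall>t\<in>Poly_Mapping.keys r. prec t m"
        using has_lm_lm[of f] by (auto simp: has_lm_def)
      have "values_on V r \<in> fun_space.span (?\<phi> ` ?S)"
      proof (rule poly)
        fix t assume "t \<in> Poly_Mapping.keys r"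
        then show "?\<phi> t \<in> fun_space.span (?\<phi> ` ?S)"
          using r(3) less[of t] by blast
      qed
      then have "(\<lambda>x. (- inverse c) * values_on V r x) \<in> fun_space.span (?\<phi> ` ?S)"
        by (rule fun_space.span_scale)
      moreover have "?\<phi> m = (\<lambda>x. (- inverse c) * values_on V r x)"
      proof
        fix x
        have "mp_eval (mono_poly m) x = (- inverse c) * mp_eval r x" if "x \<in> V"
        proof -
          have "c * mp_eval (mono_poly m) x + mp_eval r x = 0"
            using f(1) that by (simp add: vanishing_ideal_def r(2) mp_eval_single mp_eval_mono_poly)
          then have "mp_eval r x = - (c * mp_eval (mono_poly m) x)"
            by (simp add: add_eq_0_iff)
          then show ?thesis
            using r(1) by simp
        qed
        then show "?\<phi> m x = (- inverse c) * values_on V r x"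
          by (simp add: values_on_def)
      qed
      ultimately show ?thesis by simp
    qed
  qed
  show ?thesis
    using mono by (rule poly)
qed

text \<open>The restricted standard monomials and the point functions are both independent, and each
  family lies in the span of the other; comparing sizes both ways gives equality.\<close>

lemma standard_monomials_finite_card:
  assumes "finite V"
  shows "finite (standard_monomials prec (vanishing_ideal V))"
    and "card (standard_monomials prec (vanishing_ideal V)) = card V"
proof -
  let ?S = "standard_monomials prec (vanishing_ideal V)"
  let ?\<phi> = "\<lambda>m. values_on V (mono_poly m)"
  have "?\<phi> ` ?S \<subseteq> fun_space.span (point_fun ` V)"
    using values_on_in_span_points[OF assms] by blast
  then have *: "finite (?\<phi> ` ?S) \<and> card (?\<phi> ` ?S) \<le> card (point_fun ` V)"
    using assms by (intro fun_space.independent_span_bound independent_values_on_standard) auto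
  then show fin: "finite ?S"
    using inj_on_values_on finite_image_iff by blast
  have "point_fun v \<in> fun_space.span (?\<phi> ` ?S)" if v: "v \<in> V" for v
    using interpolation[OF assms v] values_on_in_span_standard by metis
  then have "card (point_fun ` V) \<le> card (?\<phi> ` ?S)"
    using * by (intro conjunct2[OF fun_space.independent_span_bound] independent_points assms) auto
  with * have "card (?\<phi> ` ?S) = card (point_fun ` V)"
    by simp
  then show "card ?S = card V"
    by (simp add: card_image[OF inj_on_values_on] card_image[OF inj_on_point_fun])
qed

subsection \<open>Leading monomials of the basis elements\<close>

lemma has_lm_var_minus: "has_lm prec (var i - of_nat j) (Poly_Mapping.single i 1)"
proof -
  have "has_lm prec (var i + (- of_nat j)) (Poly_Mapping.single i 1)"
  proof (rule has_lm_add)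
    show "has_lm prec (var i) (Poly_Mapping.single i 1)"
      unfolding var_def by (rule has_lm_mono_poly)
    fix t
    assume "t \<in> Poly_Mapping.keys (- of_nat j :: 'n mpoly)"
    then have "t = 0"
      by (simp add: in_keys_iff lookup_of_nat when_def split: if_splits)
    moreover have "Poly_Mapping.single i (1::nat) \<noteq> 0"
      by (metis lookup_single_eq lookup_zero one_neq_zero)
    ultimately show "prec t (Poly_Mapping.single i 1)"
      using prec_zero by blast
  qed
  then show ?thesis by simp
qed

lemma has_lm_grid_poly: "has_lm prec (grid_poly q i) (Poly_Mapping.single i q)"
proof -
  have "has_lm prec (grid_poly q i) (\<Sum>j<q. Poly_Mapping.single i 1)"
    unfolding grid_poly_def by (intro has_lm_prod has_lm_var_minus)
  moreover have "(\<Sum>j<q. Poly_Mapping.single i 1) = Poly_Mapping.single i q"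
    by (rule poly_mapping_eqI) (simp add: lookup_sum lookup_single when_def)
  ultimately show ?thesis by simp
qed

text \<open>In any monomial order the powers of one variable are ordered by degree, as a lower power
  properly divides a higher one.\<close>

lemma has_lm_univariate:
  assumes "p \<noteq> 0"
  shows "has_lm prec (poly (map_poly Const p) (var i)) (Poly_Mapping.single i (degree p))"
proof -
  have term_eq: "Const c * var i ^ k = Poly_Mapping.single (Poly_Mapping.single i k) c" for c k
    by (simp add: Const_def var_power mono_poly_def mult_single)
  have "has_lm prec (\<Sum>k\<le>degree p. Const (coeff p k) * var i ^ k) (Poly_Mapping.single i (degree p))"
  proof (rule has_lm_sum[where a = "degree p"])
    show "has_lm prec (Const (coeff p (degree p)) * var i ^ degree p) (Poly_Mapping.single i (degree p))"
      unfolding term_eq has_lm_def using assms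
      by (intro exI[of _ "lead_coeff p"] exI[of _ 0]) auto
    fix k t
    assume k: "k \<in> {..degree p}" "k \<noteq> degree p" and t: "t \<in> Poly_Mapping.keys (Const (coeff p k) * var i ^ k)"
    then have "t = Poly_Mapping.single i k"
      by (simp add: term_eq split: if_splits)
    moreover have "Poly_Mapping.single i (degree p) = Poly_Mapping.single i (degree p - k) + Poly_Mapping.single i k"
      using k by (simp flip: single_add)
    moreover have "Poly_Mapping.single i (degree p - k) \<noteq> 0"
      using k by (metis atMost_iff diff_is_0_eq le_antisym lookup_single_eq lookup_zero)
    ultimately show "prec t (Poly_Mapping.single i (degree p))"
      using prec_add_right[OF prec_zero] by fastforce
  qed auto
  then show ?thesis
    by (simp add: poly_map_Const)
qed

text \<open>Each term \<open>t\<close> of \<open>g\<close> turns into a polynomial whose leading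
  monomial is \<open>t\<close> raised to the power \<open>q - 1\<close>. Raising to this positive
  power keeps the order, so the contribution of \<open>m\<close> dominates.\<close>

lemma has_lm_bar:
  assumes "q \<ge> 2" "has_lm prec g m"
  shows "has_lm prec (bar q g) (\<Sum>j<q - 1. m)"
proof -
  let ?P = "\<lambda>i. poly (map_poly Const (step_poly q)) (var i) :: 'n mpoly"
  have term_lm: "has_lm prec (Const c * (\<Prod>i\<in>UNIV. ?P i ^ Poly_Mapping.lookup t i)) (\<Sum>j<q - 1. t)"
    if "c \<noteq> 0" for c t
  proof -
    have "has_lm prec (?P i) (Poly_Mapping.single i (q - 1))" for i
      using has_lm_univariate[of "step_poly q" i] step_poly_props[OF assms(1)] assms(1) by fastforce
    then have "has_lm prec (\<Prod>i\<in>UNIV. ?P i ^ Poly_Mapping.lookup t i)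
        (\<Sum>i\<in>UNIV. \<Sum>j<Poly_Mapping.lookup t i. Poly_Mapping.single i (q - 1))"
      by (intro has_lm_prod has_lm_power)
    moreover have "has_lm prec (Const c) 0"
      unfolding has_lm_def Const_def using that by (intro exI[of _ c] exI[of _ 0]) auto
    ultimately have "has_lm prec (Const c * (\<Prod>i\<in>UNIV. ?P i ^ Poly_Mapping.lookup t i))
        (0 + (\<Sum>i\<in>UNIV. \<Sum>j<Poly_Mapping.lookup t i. Poly_Mapping.single i (q - 1)))"
      by (intro has_lm_mult)
    moreover have "(\<Sum>i\<in>UNIV. \<Sum>j<Poly_Mapping.lookup t i. Poly_Mapping.single i (q - 1)) = (\<Sum>j<q - 1. t)"
    proof (rule poly_mapping_eqI)
      fix k
      have "(\<Sum>i\<in>UNIV. Poly_Mapping.lookup t i * (q - 1 when i = k))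
          = (\<Sum>i\<in>UNIV. if i = k then Poly_Mapping.lookup t k * (q - 1) else 0)"
        by (rule sum.cong) auto
      then show "Poly_Mapping.lookup (\<Sum>i\<in>UNIV. \<Sum>j<Poly_Mapping.lookup t i. Poly_Mapping.single i (q - 1)) k
          = Poly_Mapping.lookup (\<Sum>j<q - 1. t) k"
        by (simp add: lookup_sum lookup_single)
    qed
    ultimately show ?thesis by simp
  qed
  have m: "m \<in> Poly_Mapping.keys g"
    using assms(2) by (rule has_lm_in_keys)
  show ?thesis
    unfolding bar_def mp_subst_def eval_in_def
  proof (rule has_lm_sum[where a = m])
    show "has_lm prec (Const (Poly_Mapping.lookup g m) * (\<Prod>i\<in>UNIV. ?P i ^ Poly_Mapping.lookup m i)) (\<Sum>j<q - 1. m)"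
      using m by (intro term_lm) (simp add: in_keys_iff)
    fix b t
    assume b: "b \<in> Poly_Mapping.keys g" "b \<noteq> m"
      and t: "t \<in> Poly_Mapping.keys (Const (Poly_Mapping.lookup g b) * (\<Prod>i\<in>UNIV. ?P i ^ Poly_Mapping.lookup b i))"
    have "t = (\<Sum>j<q - 1. b) \<or> prec t (\<Sum>j<q - 1. b)"
      using has_lm_prec[OF term_lm t] b(1) by (auto simp: in_keys_iff)
    moreover have "prec (\<Sum>j<q - 1. b) (\<Sum>j<q - 1. m)"
      using has_lm_prec[OF assms(2) b] assms(1) by (intro prec_sum_const) auto
    ultimately show "prec t (\<Sum>j<q - 1. m)"
      using prec_trans by blast
  qed (use m in auto)
qed

end

section \<open>Standard monomials and Groebner basis of the blow-up\<close>

theorem theorem7: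
  fixes prec :: "'n::{finite,linorder} monom \<Rightarrow> 'n monom \<Rightarrow> bool"
    and q :: nat
    and F :: "'n set set"
    and G :: "'n set \<Rightarrow> 'n mpoly set"
  assumes "monomial_order prec"
    and "\<And>i j :: 'n. i < j \<Longrightarrow> prec (Poly_Mapping.single j 1) (Poly_Mapping.single i 1)"
    and "q \<ge> 2"
    and "F \<noteq> {}"
    and "\<And>J. members_above F J \<noteq> {} \<Longrightarrow>
           groebner_basis prec (family_ideal (members_above F J)) (G J)"
  shows "groebner_basis prec (vanishing_ideal (blow_up q F))
           (range (grid_poly q)
            \<union> (\<Union>J\<in>{J. members_above F J \<noteq> {}}. {mono_poly (sqf_mono J) * bar q g | g. g \<in> G J})
            \<union> {mono_poly (sqf_mono J) | J. members_above F J = {}})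
         \<and> standard_monomials prec (vanishing_ideal (blow_up q F)) =
           {v \<in> grid q. members_above F (J_set q v) \<noteq> {} \<and>
              sqf_mono (Q_set q v)
                \<in> standard_monomials prec (family_ideal (members_above F (J_set q v)))}"
proof -
  note order = assms(1) and q = assms(3) and G = assms(5)
  let ?I = "vanishing_ideal (blow_up q F)"
  let ?B = "range (grid_poly q)
            \<union> (\<Union>J\<in>{J. members_above F J \<noteq> {}}. {mono_poly (sqf_mono J) * bar q g | g. g \<in> G J})
            \<union> {mono_poly (sqf_mono J) | J. members_above F J = {}}"
  let ?S = "{v \<in> grid q. members_above F (J_set q v) \<noteq> {} \<and>
              sqf_mono (Q_set q v)
                \<in> standard_monomials prec (family_ideal (members_above F (J_set q v)))}"
  have B_sub: "?B \<subseteq> ?I"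
    using G q by (auto simp: groebner_basis_def intro: grid_poly_in_ideal mono_bar_in_ideal mono_in_ideal)
  have B_fin: "finite ?B"
    using G by (auto simp: groebner_basis_def)
  \<comment> \<open>Each kind of basis element enforces one condition of \<open>?S\<close>: the
    \<open>grid_poly\<close> bound the exponents, the bare monomials of sets \<open>J\<close>
    exclude an empty \<open>members_above\<close>, and the products with \<open>bar q g\<close>
    force the monomial of \<open>Q_set q v\<close> to be standard.\<close>
  have reduced: "v \<in> ?S" if irred: "\<And>b. b \<in> ?B \<Longrightarrow> b \<noteq> 0 \<Longrightarrow> \<not> mono_dvd (lm prec b) v" for v
  proof -
    have not_dvd: "\<not> mono_dvd m v" if "b \<in> ?B" "has_lm prec b m" for b m
      using irred[OF that(1)] has_lm_nonzero[OF order that(2)] lm_eq[OF order that(2)] by simp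
    have "Poly_Mapping.lookup v i < q" for i
    proof (rule ccontr)
      assume "\<not> ?thesis"
      then have "mono_dvd (Poly_Mapping.single i q) v"
        by (auto simp: mono_dvd_iff_lookup_le lookup_single when_def)
      moreover have "\<not> mono_dvd (Poly_Mapping.single i q) v"
        by (rule not_dvd[OF _ has_lm_grid_poly[OF order]]) auto
      ultimately show False by contradiction
    qed
    then have grid: "v \<in> grid q" by (simp add: grid_def)
    let ?J = "J_set q v" and ?Q = "Q_set q v"
    have J_dvd: "mono_dvd (sqf_mono ?J) v"
      by (auto simp: mono_dvd_iff_lookup_le lookup_sqf_mono J_set_def)
    have nonempty: "members_above F ?J \<noteq> {}"
    proof
      assume "members_above F ?J = {}"
      then have "\<not> mono_dvd (sqf_mono ?J) v"
        by (intro not_dvd[OF _ has_lm_mono_poly[OF order]]) auto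
      with J_dvd show False by contradiction
    qed
    have "sqf_mono ?Q \<in> standard_monomials prec (family_ideal (members_above F ?J))"
    proof (rule ccontr)
      assume "\<not> ?thesis"
      then obtain f where f: "f \<in> family_ideal (members_above F ?J)" "f \<noteq> 0" "lm prec f = sqf_mono ?Q"
        by (auto simp: standard_monomials_def)
      then obtain g where g: "g \<in> G ?J" "g \<noteq> 0" "mono_dvd (lm prec g) (sqf_mono ?Q)"
        using G[OF nonempty] unfolding groebner_basis_def by metis
      let ?m = "sqf_mono ?J + (\<Sum>j<q - 1. lm prec g)"
      have "has_lm prec (mono_poly (sqf_mono ?J) * bar q g) ?m"
        using q g(2) by (intro has_lm_mult has_lm_mono_poly has_lm_bar has_lm_lm order)
      then have "\<not> mono_dvd ?m v"
        using g(1) nonempty by (intro not_dvd[of "mono_poly (sqf_mono ?J) * bar q g"]) auto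
      moreover have "mono_dvd ?m v"
        unfolding mono_dvd_iff_lookup_le
      proof
        fix i
        \<comment> \<open>The leading monomial of \<open>g\<close> is squarefree with support in
          \<open>?Q\<close>, so its power has exponent at most \<open>q - 1\<close> there, which is
          the entry of \<open>v\<close>. The factor of \<open>?J\<close> adds 1 on a disjoint set
          where \<open>v\<close> is positive.\<close>
        have "Poly_Mapping.lookup (lm prec g) i \<le> (if i \<in> ?Q then 1 else 0)"
          using g(3) lookup_sqf_mono[of ?Q i] unfolding mono_dvd_iff_lookup_le by metis
        then show "Poly_Mapping.lookup ?m i \<le> Poly_Mapping.lookup v i"
          by (auto simp: lookup_add lookup_sum lookup_sqf_mono J_set_def Q_set_def split: if_splits)
      qed
      ultimately show False by contradiction
    qed
    with grid nonempty show ?thesis by simp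
  qed
  have standard_sub: "standard_monomials prec ?I \<subseteq> ?S"
  proof
    fix v
    assume v: "v \<in> standard_monomials prec ?I"
    show "v \<in> ?S"
      \<comment> \<open>A nonzero basis element whose leading monomial divides \<open>v\<close> lies
        in the ideal and would make \<open>v\<close> nonstandard.\<close>
      by (rule reduced) (use v B_sub lm_ideal_multiple[OF order] in blast)
  qed
  have family: "finite (standard_monomials prec (family_ideal (members_above F J)))"
    "card (standard_monomials prec (family_ideal (members_above F J))) \<le> card (members_above F J)" for J
  proof -
    have img: "{indicator S | S. S \<in> members_above F J} = indicator ` members_above F J"
      by auto
    have fin: "finite {indicator S :: 'n \<Rightarrow> rat | S. S \<in> members_above F J}"
      unfolding img by simp
    show "finite (standard_monomials prec (family_ideal (members_above F J)))"
      unfolding family_ideal_def by (rule standard_monomials_finite_card(1)[OF order fin])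
    show "card (standard_monomials prec (family_ideal (members_above F J))) \<le> card (members_above F J)"
      unfolding family_ideal_def standard_monomials_finite_card(2)[OF order fin]
      unfolding img by (rule card_image_le) simp
  qed
  have "finite ?S"
    by (rule finite_subset[OF _ finite_grid[of q]]) auto
  \<comment> \<open>Candidates inject into the grid points with support in \<open>F\<close>; these
    correspond to the points of the blow-up, which are as many as the standard monomials. With the
    inclusion above this forces equality.\<close>
  moreover have "card ?S \<le> card (standard_monomials prec ?I)"
    unfolding standard_monomials_finite_card(2)[OF order finite_card_blow_up(1)] finite_card_blow_up(2)
    by (rule card_candidates_le[OF q family])
  ultimately have standard: "standard_monomials prec ?I = ?S"
    using standard_sub by (intro card_seteq)
  have "\<exists>b\<in>?B. b \<noteq> 0 \<and> mono_dvd (lm prec b) (lm prec f)" if f: "f \<in> ?I" "f \<noteq> 0" for f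
  proof (rule ccontr)
    assume "\<not> ?thesis"
    then have "lm prec f \<in> ?S"
      by (intro reduced) blast
    then have "lm prec f \<in> standard_monomials prec ?I"
      unfolding standard .
    then show False
      using f by (auto simp: standard_monomials_def)
  qed
  with B_sub B_fin have "groebner_basis prec ?I ?B"
    unfolding groebner_basis_def by blast
  then show ?thesis
    using standard by (rule conjI)
qed

end
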